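(* The performance bound $\gamma^*$, i.e. the optimal value of Problem (V$_T$) defined in the context, is monotonically nonincreasing with respect to the data length $T$: when a data trajectory of length $T$ is extended by one further data point to length $T+1$ (the earlier data being kept), the optimal value of Problem (V$_{T+1}$) is less than or equal to the optimal value of Problem (V$_T$).
   Context: $\mathbb{S}^{n}_{++}$ denotes the set of real symmetric positive definite $n\times n$ matrices; $\succ,\succeq$ denote the Loewner order. Fixed matrices: $C\in\mathbb{R}^{n_y\times n_x}$, $D\in\mathbb{R}^{n_y\times n_u}$, $G\in\mathbb{R}^{n_x\times n_d}$, $H\in\mathbb{R}^{n_y\times n_d}$. Data: states $x_0,x_1,\ldots\in\mathbb{R}^{n_x}$ and inputs $u_0,u_1,\ldots\in\mathbb{R}^{n_u}$ are collected along a trajectory of $x_{k+1}=A_*x_k+B_*u_k+w_k$ with unknown matrices $A_*,B_*$ and unknown noise satisfying $\|w_k\|_2\le\epsilon$ for all $k$, where $\epsilon>0$ is known. Data of length $T$ (a positive integer) means $x_0,\ldots,x_T$ and $u_0,\ldots,u_{T-1}$. For each $i$ define the symmetric matrix of size $2n_x+n_u$ $$\Psi_i=\begin{bmatrix} I & x_{i+1}\\ 0&-x_i\\ 0&-u_i\end{bmatrix}\begin{bmatrix}\epsilon^2 I&0\\ 0&-1\end{bmatrix}\begin{bmatrix} I & x_{i+1}\\ 0&-x_i\\ 0&-u_i\end{bmatrix}^\top .$$ Problem (V$_T$) (data-driven unstructured $H_\infty$ design with data length $T$): minimize $\gamma$ over $P,L,R,\{\alpha_i\}_{i=0,\ldots,T-1},\beta,\gamma$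 (with $L\in\mathbb{R}^{n_u\times n_x}$, $\alpha_i,\beta$ real scalars, $\gamma\ge0$) subject to (a) $\begin{bmatrix}P-GG^\top-\beta I&0&GH^\top\\ 0&-R&R\begin{bmatrix}C^\top\\ D^\top\end{bmatrix}\\ HG^\top&\begin{bmatrix}C&D\end{bmatrix}R&\gamma^2I-\begin{bmatrix}C&D\end{bmatrix}R\begin{bmatrix}C^\top\\ D^\top\end{bmatrix}-HH^\top\end{bmatrix}-\begin{bmatrix}\sum_{i=0}^{T-1}\alpha_i\Psi_i&0\\ 0&0\end{bmatrix}\succeq0$, where the row/column blocks of the first matrix have sizes $n_x,\,n_x+n_u,\,n_y$ and the second matrix is partitioned with blocks of sizes $2n_x+n_u$ and $n_y$; (b) $\begin{bmatrix}R-\begin{bmatrix}P&L^\top\\ L&0\end{bmatrix}&\begin{bmatrix}0\\ L\end{bmatrix}\\ \begin{bmatrix}0&L^\top\end{bmatrix}&P\end{bmatrix}\succ0$; (c) $\alpha_0\ge0,\ldots,\alpha_{T-1}\ge0$, $\beta>0$; (d) $P\in\mathbb{S}^{n_x}_{++}$, $R\in\mathbb{S}^{n_x+n_u}_{++}$. The optimal value is the infimum of $\gamma$ over the feasible set, equal to $+\infty$ if the feasible set is empty. *)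

theory Defs
  imports "HOL-Analysis.Analysis"
begin

definition positive_semidefinite :: "real^'n^'n \<Rightarrow> bool" where
  "positive_semidefinite M \<longleftrightarrow> transpose M = M \<and> (\<forall>v. v \<bullet> (M *v v) \<ge> 0)"

definition positive_definite :: "real^'n^'n \<Rightarrow> bool" where
  "positive_definite M \<longleftrightarrow> transpose M = M \<and> (\<forall>v. v \<noteq> 0 \<longrightarrow> v \<bullet> (M *v v) > 0)"

text \<open>Block matrices are indexed by sum types. In \<open>real^'m^'n\<close> the index type of the rows
  is \<open>'n\<close> and that of the columns is \<open>'m\<close>.\<close>

definition hcat :: "real^'a^'n \<Rightarrow> real^'b^'n \<Rightarrow> real^('a + 'b)^'n" where
  "hcat A B = (\<chi> i j. case j of Inl a \<Rightarrow> A $ i $ a | Inr b \<Rightarrow> B $ i $ b)"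

definition vcat :: "real^'m^'a \<Rightarrow> real^'m^'b \<Rightarrow> real^'m^('a + 'b)" where
  "vcat A B = (\<chi> i. case i of Inl a \<Rightarrow> A $ a | Inr b \<Rightarrow> B $ b)"

definition block2 ::
  "real^'a^'c \<Rightarrow> real^'b^'c \<Rightarrow> real^'a^'d \<Rightarrow> real^'b^'d \<Rightarrow> real^('a + 'b)^('c + 'd)" where
  "block2 A B C D = vcat (hcat A B) (hcat C D)"

definition data_factor ::
  "(nat \<Rightarrow> real^'nx) \<Rightarrow> (nat \<Rightarrow> real^'nu) \<Rightarrow> nat \<Rightarrow> real^('nx + 1)^('nx + ('nx + 'nu))" where
  "data_factor x u i =
     vcat (hcat (mat 1) (columnvector (x (Suc i))))
    (vcat (hcat 0 (- columnvector (x i)))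
          (hcat 0 (- columnvector (u i))))"

definition Psi ::
  "real \<Rightarrow> (nat \<Rightarrow> real^'nx) \<Rightarrow> (nat \<Rightarrow> real^'nu) \<Rightarrow> nat
    \<Rightarrow> real^('nx + ('nx + 'nu))^('nx + ('nx + 'nu))" where
  "Psi \<epsilon> x u i =
     data_factor x u i ** block2 (\<epsilon>\<^sup>2 *\<^sub>R mat 1) 0 0 (- mat 1) ** transpose (data_factor x u i)"

text \<open>The row and column blocks are grouped as \<open>('nx + ('nx + 'nu)) + 'ny\<close>, so that the same
  matrix carries the partition into sizes \<open>n\<^sub>x\<close>, \<open>n\<^sub>x + n\<^sub>u\<close>, \<open>n\<^sub>y\<close> and the one into sizes
  \<open>2 n\<^sub>x + n\<^sub>u\<close>, \<open>n\<^sub>y\<close>.\<close>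

definition performance_matrix ::
  "real^'nx^'ny \<Rightarrow> real^'nu^'ny \<Rightarrow> real^'nd^'nx \<Rightarrow> real^'nd^'ny
    \<Rightarrow> real^'nx^'nx \<Rightarrow> real^('nx + 'nu)^('nx + 'nu) \<Rightarrow> real \<Rightarrow> real
    \<Rightarrow> real^(('nx + ('nx + 'nu)) + 'ny)^(('nx + ('nx + 'nu)) + 'ny)" where
  "performance_matrix C D G H P R \<beta> \<gamma> =
     vcat
       (vcat
         (hcat (hcat (P - G ** transpose G - \<beta> *\<^sub>R mat 1) 0) (G ** transpose H))
         (hcat (hcat 0 (- R)) (R ** vcat (transpose C) (transpose D))))
       (hcat (hcat (H ** transpose G) (hcat C D ** R))
         (\<gamma>\<^sup>2 *\<^sub>R mat 1 - hcat C D ** R ** vcat (transpose C) (transpose D) - H ** transpose H))"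

definition stability_matrix ::
  "real^'nx^'nx \<Rightarrow> real^'nx^'nu \<Rightarrow> real^('nx + 'nu)^('nx + 'nu)
    \<Rightarrow> real^(('nx + 'nu) + 'nx)^(('nx + 'nu) + 'nx)" where
  "stability_matrix P L R =
     block2 (R - block2 P (transpose L) L 0) (vcat 0 L)
            (hcat 0 (transpose L))           P"

text \<open>Only \<open>x 0, \<dots>, x T\<close>, \<open>u 0, \<dots>, u (T - 1)\<close> and \<open>\<alpha> 0, \<dots>, \<alpha> (T - 1)\<close> are relevant.\<close>

definition feasible ::
  "real^'nx^'ny \<Rightarrow> real^'nu^'ny \<Rightarrow> real^'nd^'nx \<Rightarrow> real^'nd^'ny \<Rightarrow> real
    \<Rightarrow> (nat \<Rightarrow> real^'nx) \<Rightarrow> (nat \<Rightarrow> real^'nu) \<Rightarrow> nat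
    \<Rightarrow> real^'nx^'nx \<Rightarrow> real^'nx^'nu \<Rightarrow> real^('nx + 'nu)^('nx + 'nu)
    \<Rightarrow> (nat \<Rightarrow> real) \<Rightarrow> real \<Rightarrow> real \<Rightarrow> bool" where
  "feasible C D G H \<epsilon> x u T P L R \<alpha> \<beta> \<gamma> \<longleftrightarrow>
     positive_semidefinite
       (performance_matrix C D G H P R \<beta> \<gamma> - block2 (\<Sum>i<T. \<alpha> i *\<^sub>R Psi \<epsilon> x u i) 0 0 0) \<and>
     positive_definite (stability_matrix P L R) \<and>
     (\<forall>i<T. \<alpha> i \<ge> 0) \<and> \<beta> > 0 \<and>
     positive_definite P \<and> positive_definite R \<and>
     \<gamma> \<ge> 0"

text \<open>The infimum is taken in the extended reals, where \<open>Inf {} = \<infinity>\<close>.\<close>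

definition optimal_value ::
  "real^'nx^'ny \<Rightarrow> real^'nu^'ny \<Rightarrow> real^'nd^'nx \<Rightarrow> real^'nd^'ny \<Rightarrow> real
    \<Rightarrow> (nat \<Rightarrow> real^'nx) \<Rightarrow> (nat \<Rightarrow> real^'nu) \<Rightarrow> nat \<Rightarrow> ereal" where
  "optimal_value C D G H \<epsilon> x u T =
     Inf {ereal \<gamma> | \<gamma>. \<exists>P L R \<alpha> \<beta>. feasible C D G H \<epsilon> x u T P L R \<alpha> \<beta> \<gamma>}"

end

theory Submission
  imports Defs
begin

text \<open>Lengthening the trajectory by one step adds a decision variable, the multiplier
  \<open>\<alpha> T\<close>, together with the single constraint \<open>\<alpha> T \<ge> 0\<close>, and changes nothing else. The choice
  \<open>\<alpha> T = 0\<close> switches the new data matrix off, so every value of \<open>\<gamma>\<close> attainable with the shorter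
  trajectory stays attainable with the longer one. The infimum is then taken over a larger set;
  if the shorter problem is infeasible, its value is \<open>\<infinity>\<close>.\<close>

lemma feasible_extend_by_zero_multiplier:
  assumes "feasible C D G H \<epsilon> x u T P L R \<alpha> \<beta> \<gamma>"
  shows "feasible C D G H \<epsilon> x u (Suc T) P L R (\<alpha>(T := 0)) \<beta> \<gamma>"
proof -
  have "(\<Sum>i<Suc T. (\<alpha>(T := 0)) i *\<^sub>R Psi \<epsilon> x u i) = (\<Sum>i<T. \<alpha> i *\<^sub>R Psi \<epsilon> x u i)"
    by simp
  then show ?thesis
    using assms unfolding feasible_def by (simp add: less_Suc_eq)
qed

theorem theorem5:
  fixes C :: "real^'nx^'ny" and D :: "real^'nu^'ny"
    and G :: "real^'nd^'nx" and H :: "real^'nd^'ny"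
    and A :: "real^'nx^'nx" and B :: "real^'nu^'nx"
    and x w :: "nat \<Rightarrow> real^'nx" and u :: "nat \<Rightarrow> real^'nu"
    and \<epsilon> :: real and T :: nat
  assumes "\<epsilon> > 0" and "T > 0"
    and "\<And>k. k < T + 1 \<Longrightarrow> x (k + 1) = A *v x k + B *v u k + w k"
    and "\<And>k. k < T + 1 \<Longrightarrow> norm (w k) \<le> \<epsilon>"
  shows "optimal_value C D G H \<epsilon> x u (T + 1) \<le> optimal_value C D G H \<epsilon> x u T"
  unfolding optimal_value_def Suc_eq_plus1[symmetric]
  by (rule Inf_superset_mono) (blast intro: feasible_extend_by_zero_multiplier)

end
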